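(* Let $N\subseteq\mathbb{M}$ be a submagma and $k\ge0$ an integer. Then $N$ is $k$-maximal (in the lattice $\mathbf{Sub}(\mathbb{M})$) if and only if $|\mathbb{M}\setminus N|=k$.
   Context: $\mathbb{M}$ is the free magma on one generator $1$ (its elements are identified with finite full binary trees, $x+y$ being the tree obtained by joining $x$ and $y$ under a new root). A submagma is a subset closed under $+$; the empty set is counted as a submagma. $\mathbf{Sub}(\mathbb{M})$ is the set of all submagmas ordered by inclusion, with greatest element $\mathbb{M}$. A submagma $N$ is $k$-maximal iff the longest ascending chain from $N$ to $\mathbb{M}$ has length $k$, i.e. there is a chain of submagmas $N=N_0\subsetneq N_1\subsetneq\cdots\subsetneq N_k=\mathbb{M}$ and no such chain with more than $k$ strict inclusions exists. *)

theory Defs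
  imports Main
begin

text \<open>The free magma on one generator, as the type of finite full binary trees:
  \<open>Gen\<close> is the generator \<open>1\<close> (the one-leaf tree) and \<open>x \<oplus> y\<close> joins
  \<open>x\<close> and \<open>y\<close> under a new root. The whole magma is \<open>UNIV :: free_magma set\<close>.\<close>

datatype free_magma =
    Gen
  | Join free_magma free_magma (infixl "\<oplus>" 65)

text \<open>The empty set counts as a submagma.\<close>

definition submagma :: "free_magma set \<Rightarrow> bool" where
  "submagma N \<longleftrightarrow> (\<forall>x\<in>N. \<forall>y\<in>N. x \<oplus> y \<in> N)"

definition Sub :: "free_magma set set" where
  "Sub = {N. submagma N}"

text \<open>\<open>ascending_chain N c m\<close>: \<open>c 0 \<subset> c 1 \<subset> \<dots> \<subset> c m\<close> is a chain in \<open>Sub\<close> from \<open>N\<close> to the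
  whole magma. Its length is the number \<open>m\<close> of strict inclusions; values \<open>c i\<close> with
  \<open>i > m\<close> are irrelevant.\<close>

definition ascending_chain ::
  "free_magma set \<Rightarrow> (nat \<Rightarrow> free_magma set) \<Rightarrow> nat \<Rightarrow> bool" where
  "ascending_chain N c m \<longleftrightarrow>
     (\<forall>i\<le>m. c i \<in> Sub) \<and> c 0 = N \<and> c m = UNIV \<and> (\<forall>i<m. c i \<subset> c (Suc i))"

definition k_maximal :: "nat \<Rightarrow> free_magma set \<Rightarrow> bool" where
  "k_maximal k N \<longleftrightarrow>
     (\<exists>c. ascending_chain N c k) \<and> (\<forall>m c. ascending_chain N c m \<longrightarrow> m \<le> k)"

end

theory Submission
  imports Defs
begin

text \<open>Joining with anything strictly increases the size of a tree. Hence adding to a submagma \<open>N\<close>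
  of finite complement a largest missing tree gives again a submagma, and iterating this
  builds a chain of length equal to the cardinality of the complement; no chain can be longer.
  If the complement is infinite, adding to \<open>N\<close> all trees of size at least \<open>n\<close> gives submagmas
  of finite but arbitrarily large complement, so chains from \<open>N\<close> have unbounded length.\<close>

text \<open>Apart from \<open>Gen\<close>, a tree of size at most \<open>n\<close> is a join of two
  trees of size less than \<open>n\<close>.\<close>

lemma finite_size_less: "finite {x :: free_magma. size x < n}"
proof (induction n)
  case (Suc n)
  let ?S = "{x :: free_magma. size x < n}"
  have "{x. size x < Suc n} \<subseteq> insert Gen ((\<lambda>(x, y). x \<oplus> y) ` (?S \<times> ?S))"
  proof
    fix x :: free_magma
    assume "x \<in> {x. size x < Suc n}"
    then show "x \<in> insert Gen ((\<lambda>(x, y). x \<oplus> y) ` (?S \<times> ?S))"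
      by (cases x) auto
  qed
  with Suc show ?case
    by (meson finite_SigmaI finite_imageI finite_insert finite_subset)
qed simp

text \<open>Any join with \<open>x\<close> as a summand is strictly larger than \<open>x\<close>, so
  it cannot be missing from \<open>N\<close>.\<close>

lemma Sub_insert_largest:
  assumes "N \<in> Sub" and "\<And>y. y \<notin> N \<Longrightarrow> size y \<le> size x"
  shows "insert x N \<in> Sub"
proof -
  have "y \<oplus> z \<in> N" if "y = x \<or> z = x" for y z
  proof (rule ccontr)
    assume "y \<oplus> z \<notin> N"
    from assms(2)[OF this] that show False by auto
  qed
  with assms(1) show ?thesis
    by (auto simp: Sub_def submagma_def)
qed

text \<open>A join is at least as large as each summand, so one summand of size at least
  \<open>n\<close> suffices.\<close>

lemma Sub_Un_size_ge:
  assumes "N \<in> Sub"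
  shows "N \<union> {x. n \<le> size x} \<in> Sub"
  using assms by (auto simp: Sub_def submagma_def)

lemma ascending_chain_cofinite:
  assumes "N \<in> Sub" and "finite (- N)"
  shows "\<exists>c. ascending_chain N c (card (- N))"
  using assms
proof (induction "card (- N)" arbitrary: N)
  case 0
  then have "N = UNIV" by auto
  with 0 have "ascending_chain N (\<lambda>_. N) (card (- N))"
    by (simp add: ascending_chain_def)
  then show ?case by blast
next
  case (Suc m)
  have ne: "- N \<noteq> {}" using Suc.hyps(2) by auto
  let ?m = "Max (size ` (- N))"
  have "?m \<in> size ` (- N)" using Suc.prems(2) ne by (intro Max_in) auto
  then obtain x where x: "x \<notin> N" and "size x = ?m" by auto
  with Suc.prems(2) have largest: "\<And>y. y \<notin> N \<Longrightarrow> size y \<le> size x" by simp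
  have eq: "- insert x N = - N - {x}" by auto
  have card: "m = card (- insert x N)"
    using Suc.hyps(2) x by (simp add: eq)
  obtain c where c: "ascending_chain (insert x N) c m"
    using Suc.hyps(1)[OF card Sub_insert_largest[OF Suc.prems(1) largest]] Suc.prems(2) card
    by (auto simp: eq)
  have "ascending_chain N (case_nat N c) (Suc m)"
    unfolding ascending_chain_def
  proof (intro conjI allI impI)
    fix i assume "i \<le> Suc m"
    then show "case_nat N c i \<in> Sub"
      using c Suc.prems(1) by (cases i) (simp_all add: ascending_chain_def)
  next
    fix i assume "i < Suc m"
    then show "case_nat N c i \<subset> case_nat N c (Suc i)"
      using c x by (cases i) (auto simp: ascending_chain_def)
  qed (use c in \<open>simp_all add: ascending_chain_def\<close>)
  with Suc.hyps(2) show ?case by auto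
qed

lemma ascending_chain_length_le:
  assumes "ascending_chain N c m" and "finite (- N)"
  shows "m \<le> card (- N)"
proof -
  \<comment> \<open>Each strict inclusion uses up at least one element of the complement; finiteness
    is carried along so that cardinalities strictly drop.\<close>
  have "finite (- c i) \<and> card (- c i) + i \<le> card (- N)" if "i \<le> m" for i
    using that
  proof (induction i)
    case 0
    then show ?case using assms by (simp add: ascending_chain_def)
  next
    case (Suc i)
    then have "- c (Suc i) \<subset> - c i"
      using assms(1) by (auto simp: ascending_chain_def)
    moreover have "finite (- c i)" using Suc by simp
    ultimately have "finite (- c (Suc i))" "card (- c (Suc i)) < card (- c i)"
      by (auto intro: finite_subset psubset_card_mono)
    with Suc show ?case by simp
  qed
  from this[of m] show ?thesis by simp
qed

text \<open>Transfers lengths of chains from \<open>M\<close> to a smaller \<open>N\<close>. With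
  \<open>0 < m\<close>, changing the value at 0 leaves the end \<open>c m = UNIV\<close>
  intact.\<close>

lemma ascending_chain_shrink_start:
  assumes "ascending_chain M c m" and "0 < m" and "N \<in> Sub" and "N \<subseteq> M"
  shows "ascending_chain N (c(0 := N)) m"
  unfolding ascending_chain_def
proof (intro conjI allI impI)
  fix i assume "i < m"
  then have "c i \<subset> c (Suc i)" using assms(1) by (simp add: ascending_chain_def)
  with assms(1,4) show "(c(0 := N)) i \<subset> (c(0 := N)) (Suc i)"
    by (cases "i = 0") (auto simp: ascending_chain_def)
qed (use assms in \<open>auto simp: ascending_chain_def\<close>)

lemma k_maximal_cofinite:
  assumes "N \<in> Sub" and "finite (- N)"
  shows "k_maximal (card (- N)) N"
  unfolding k_maximal_def
  using ascending_chain_cofinite[OF assms] ascending_chain_length_le[OF _ assms(2)] by blast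

lemma k_maximal_unique: "k_maximal k N \<Longrightarrow> k_maximal l N \<Longrightarrow> k = l"
  unfolding k_maximal_def by (intro le_antisym) blast+

lemma k_maximal_imp_cofinite:
  assumes "N \<in> Sub" and "k_maximal k N"
  shows "finite (- N)"
proof (rule ccontr)
  assume "infinite (- N)"
  then obtain F where F: "F \<subseteq> - N" "finite F" "card F = Suc k"
    using infinite_arbitrarily_large by blast
  \<comment> \<open>This threshold exceeds every size in \<open>F\<close>, so all
    \<open>k + 1\<close> trees of \<open>F\<close> stay outside \<open>M\<close>, while
    \<open>M\<close> misses only trees of size below \<open>n\<close>.\<close>
  define n where "n = Suc (Max (size ` F))"
  define M where "M = N \<union> {x. n \<le> size x}"
  have "M \<in> Sub"
    unfolding M_def using assms(1) by (rule Sub_Un_size_ge)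
  have fin: "finite (- M)"
    by (rule finite_subset[OF _ finite_size_less[of n]]) (auto simp: M_def)
  have "size x < n" if "x \<in> F" for x
    using F(2) that by (simp add: n_def less_Suc_eq_le)
  then have "F \<subseteq> - M"
    using F(1) by (fastforce simp: M_def)
  with fin F(3) have card: "Suc k \<le> card (- M)"
    by (metis card_mono)
  obtain c where "ascending_chain M c (card (- M))"
    using ascending_chain_cofinite[OF \<open>M \<in> Sub\<close> fin] ..
  then have "ascending_chain N (c(0 := N)) (card (- M))"
    by (rule ascending_chain_shrink_start) (use card assms(1) in \<open>auto simp: M_def\<close>)
  with assms(2) have "card (- M) \<le> k"
    by (auto simp: k_maximal_def)
  with card show False by simp
qed

theorem theorem6p10:
  fixes N :: "free_magma set" and k :: nat
  assumes "N \<in> Sub"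
  shows "k_maximal k N \<longleftrightarrow> finite (UNIV - N) \<and> card (UNIV - N) = k"
proof
  assume k: "k_maximal k N"
  then have fin: "finite (- N)"
    by (rule k_maximal_imp_cofinite[OF assms])
  \<comment> \<open>The maximal length is unique, and the cardinality of the finite complement is
    already one.\<close>
  with k_maximal_unique[OF k_maximal_cofinite[OF assms fin] k]
  show "finite (UNIV - N) \<and> card (UNIV - N) = k"
    by (simp add: Compl_eq_Diff_UNIV)
next
  assume "finite (UNIV - N) \<and> card (UNIV - N) = k"
  with k_maximal_cofinite[OF assms] show "k_maximal k N"
    by (simp add: Compl_eq_Diff_UNIV)
qed

end
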